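(* Let $\lambda>-1$ be a real number, let $w$ be a positive integer, and let $m_0,m_1,\dots,m_{w-1}$ be positive integers. Then the sequence $$\left\{\prod_{k=0}^{w-1}\big(n(n+1+2\lambda)-k(k+1+2\lambda)\big)^{m_k}\right\}_{n=0}^{\infty}$$ is a $P^{(\lambda)}$-CZDS, where $P^{(\lambda)}=\{P_n^{(\lambda)}(x)\}_{n=0}^\infty$ is the set of ultraspherical polynomials.
   Context: For a non-zero function $f$, $Z_C(f)$ denotes the number of non-real zeros of $f$ in $\mathbb{C}$, counted according to multiplicity; for the identically zero function, $Z_C(0)=0$. Let $B=\{b_k\}_{k=0}^\infty$ be a basis of $\mathbb{R}[x]$. A sequence of real numbers $\{\gamma_k\}_{k=0}^\infty$ is a complex zero decreasing sequence for the basis $B$ (a $B$-CZDS) if the linear operator $L:\mathbb{R}[x]\to\mathbb{R}[x]$ determined by $L(b_k)=\gamma_k b_k$ ($k=0,1,2,\dots$) satisfies $Z_C(L(p))\le Z_C(p)$ for every real polynomial $p$. For real $\alpha,\beta>-1$, the Jacobi polynomials are $$P_n^{(\alpha,\beta)}(x)=\frac{(-1)^n(1-x)^{-\alpha}(1+x)^{-\beta}}{2^n n!}\frac{d^n}{dx^n}\left[(1-x)^{n+\alpha}(1+x)^{n+\beta}\right]\qquad(n=0,1,2,\dots),$$ where the right-hand side is computed on $(-1,1)$ and is a polynomial of degree $n$. For $\lambda>-1$, the ultraspherical polynomials are $P_n^{(\lambda)}(x):=P_n^{(\lambda,\lambda)}(x)$. *)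

theory Defs
  imports "HOL-Analysis.Analysis" "HOL-Computational_Algebra.Polynomial"
begin

definition nonreal_zero_count :: "real poly \<Rightarrow> nat" where
  "nonreal_zero_count p =
     (if p = 0 then 0
      else \<Sum>z \<in> {z. z \<notin> \<real> \<and> poly (map_poly complex_of_real p) z = 0}.
             order z (map_poly complex_of_real p))"

interpretation real_poly: vector_space "smult :: real \<Rightarrow> real poly \<Rightarrow> real poly"
  by unfold_locales (simp_all add: smult_add_right smult_add_left)

definition is_poly_basis :: "(nat \<Rightarrow> real poly) \<Rightarrow> bool" where
  "is_poly_basis b \<longleftrightarrow>
     inj b \<and> real_poly.independent (range b) \<and> real_poly.span (range b) = UNIV"

(* Since b is a basis, the operator L below exists and is unique. *)
definition CZDS :: "(nat \<Rightarrow> real poly) \<Rightarrow> (nat \<Rightarrow> real) \<Rightarrow> bool" where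
  "CZDS b \<gamma> \<longleftrightarrow>
     is_poly_basis b \<and>
     (\<exists>L. Vector_Spaces.linear smult smult L \<and>
          (\<forall>k. L (b k) = smult (\<gamma> k) (b k)) \<and>
          (\<forall>p. nonreal_zero_count (L p) \<le> nonreal_zero_count p))"

definition jacobi_rodrigues :: "nat \<Rightarrow> real \<Rightarrow> real \<Rightarrow> real \<Rightarrow> real" where
  "jacobi_rodrigues n \<alpha> \<beta> x =
     (-1) ^ n * (1 - x) powr (- \<alpha>) * (1 + x) powr (- \<beta>) / (2 ^ n * fact n) *
     (deriv ^^ n) (\<lambda>t. (1 - t) powr (real n + \<alpha>) * (1 + t) powr (real n + \<beta>)) x"

definition jacobi_poly :: "nat \<Rightarrow> real \<Rightarrow> real \<Rightarrow> real poly" where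
  "jacobi_poly n \<alpha> \<beta> =
     (THE p. \<forall>x\<in>{-1<..<1}. poly p x = jacobi_rodrigues n \<alpha> \<beta> x)"

definition ultraspherical_poly :: "real \<Rightarrow> nat \<Rightarrow> real poly" where
  "ultraspherical_poly l n = jacobi_poly n l l"

lemma iterated_deriv_jacobi_weight:
  fixes a b :: real
  shows "\<exists>q. \<forall>x\<in>{-1<..<1}.
           (deriv ^^ k) (\<lambda>t. (1 - t) powr a * (1 + t) powr b) x =
           (1 - x) powr (a - real k) * (1 + x) powr (b - real k) * poly q x"
proof (induction k)
  case 0
  show ?case by (rule exI[of _ 1]) simp
next
  case (Suc k)
  let ?w = "\<lambda>t. (1 - t) powr a * (1 + t) powr b :: real"
  obtain q where q: "\<And>x. x \<in> {-1<..<1} \<Longrightarrow> (deriv ^^ k) ?w x =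
      (1 - x) powr (a - real k) * (1 + x) powr (b - real k) * poly q x"
    using Suc.IH by blast
  define c where "c = a - real k"
  define d where "d = b - real k"
  define r where "r = [:1,1:] * smult (- c) q + [:1,-1:] * smult d q + [:1,0,-1:] * pderiv q"
  have "(deriv ^^ Suc k) ?w x =
      (1 - x) powr (a - real (Suc k)) * (1 + x) powr (b - real (Suc k)) * poly r x"
    if x: "x \<in> {-1<..<1}" for x
  proof -
    have pos: "1 - x > 0" "1 + x > 0" using x by auto
    have "eventually (\<lambda>y. y \<in> {-1<..<1}) (nhds x)"
      using x by (intro eventually_nhds_in_open) auto
    hence ev: "eventually (\<lambda>y. (deriv ^^ k) ?w y = (1 - y) powr c * (1 + y) powr d * poly q y) (nhds x)"
      by eventually_elim (simp add: q c_def d_def)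
    have "(deriv ^^ Suc k) ?w x = deriv (\<lambda>y. (1 - y) powr c * (1 + y) powr d * poly q y) x"
      using deriv_cong_ev[OF ev] by simp
    also have "\<dots> = (1 - x) powr (c - 1) * (1 + x) powr (d - 1) * poly r x"
    proof (rule DERIV_imp_deriv)
      have c1: "(1 - x) powr c = (1 - x) powr (c - 1) * (1 - x)"
        using pos by (simp add: powr_diff)
      have d1: "(1 + x) powr d = (1 + x) powr (d - 1) * (1 + x)"
        using pos by (simp add: powr_diff)
      have "((\<lambda>y. (1 - y) powr c * (1 + y) powr d * poly q y) has_real_derivative
          ((- (c * (1 - x) powr (c - 1))) * (1 + x) powr d
            + d * (1 + x) powr (d - 1) * (1 - x) powr c) * poly q x
          + poly (pderiv q) x * ((1 - x) powr c * (1 + x) powr d)) (at x)"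
        using pos by (auto intro!: derivative_eq_intros simp: powr_diff)
      thus "((\<lambda>y. (1 - y) powr c * (1 + y) powr d * poly q y) has_real_derivative
          (1 - x) powr (c - 1) * (1 + x) powr (d - 1) * poly r x) (at x)"
        unfolding c1 d1 r_def by (simp add: algebra_simps)
    qed
    finally show ?thesis by (simp add: c_def d_def algebra_simps)
  qed
  thus ?case by blast
qed

lemma ex1_jacobi_poly:
  "\<exists>!p. \<forall>x\<in>{-1<..<1}. poly p x = jacobi_rodrigues n \<alpha> \<beta> x"
proof (rule ex_ex1I)
  obtain q where q: "\<forall>x\<in>{-1<..<1}.
      (deriv ^^ n) (\<lambda>t. (1 - t) powr (real n + \<alpha>) * (1 + t) powr (real n + \<beta>)) x =
      (1 - x) powr (real n + \<alpha> - real n) * (1 + x) powr (real n + \<beta> - real n) * poly q x"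
    using iterated_deriv_jacobi_weight by blast
  have "\<forall>x\<in>{-1<..<1}. poly (smult ((-1) ^ n / (2 ^ n * fact n)) q) x = jacobi_rodrigues n \<alpha> \<beta> x"
    using q by (auto simp: jacobi_rodrigues_def powr_minus field_simps)
  thus "\<exists>p. \<forall>x\<in>{-1<..<1}. poly p x = jacobi_rodrigues n \<alpha> \<beta> x" ..
next
  fix p q
  assume p: "\<forall>x\<in>{-1<..<1}. poly p x = jacobi_rodrigues n \<alpha> \<beta> x"
    and q: "\<forall>x\<in>{-1<..<1}. poly q x = jacobi_rodrigues n \<alpha> \<beta> x"
  have "{-1<..<1} \<subseteq> {x. poly (p - q) x = 0}" using p q by auto
  moreover have "infinite {-1<..<1::real}" by simp
  ultimately have "infinite {x. poly (p - q) x = 0}" using finite_subset by blast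
  thus "p = q" using poly_roots_finite[of "p - q"] by auto
qed

lemma poly_jacobi_poly:
  "x \<in> {-1<..<1} \<Longrightarrow> poly (jacobi_poly n \<alpha> \<beta>) x = jacobi_rodrigues n \<alpha> \<beta> x"
  using theI'[OF ex1_jacobi_poly] unfolding jacobi_poly_def by blast

end

theory Submission
  imports Defs "HOL-Computational_Algebra.Fundamental_Theorem_Algebra"
begin

text \<open>
  Write \<open>D\<close> for differentiation and \<open>A\<^sub>c q = (x\<^sup>2 - 1) q' + 2 c x q\<close>. Away from \<open>\<plusminus>1\<close> this is, up to sign,
  \<open>\<bar>x\<^sup>2 - 1\<bar>\<close> to the power \<open>1 - c\<close> times the derivative of \<open>\<bar>x\<^sup>2 - 1\<bar>\<^sup>c q\<close>. Rolle's theorem shows that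
  \<open>D\<close> loses at most one real zero, and that \<open>A\<^sub>c\<close> with \<open>c > 0\<close> gains at least one, since the weight adds
  zeros at \<open>\<plusminus>1\<close>. As \<open>D\<close> lowers the degree by one and \<open>A\<^sub>c\<close> raises it by one, neither operator increases
  the number of non-real zeros (\<open>nonreal_zero_count_pderiv_le\<close>,
  \<open>nonreal_zero_count_jacobi_raise_le\<close>).

  The ultraspherical polynomials with parameter \<open>l\<close> are eigenvectors of \<open>T\<^sub>l = A\<^bsub>l+1\<^esub> D\<close> with
  eigenvalues \<open>\<mu>\<^sub>l(n) = n (n + 1 + 2 l)\<close>, so the multiplier operator in question is the product over
  \<open>k < w\<close> of the powers \<open>(T\<^sub>l - \<mu>\<^sub>l(k))\<close> to the \<open>m\<^sub>k\<close>. The zero count does not apply to a single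
  factor \<open>T\<^sub>l - \<mu>\<^sub>l(k)\<close> with \<open>k > 0\<close>, but it applies to the product, because of the intertwining relation
  \<open>D (T\<^sub>l - \<mu>\<^sub>l(k + 1)) = (T\<^bsub>l+1\<^esub> - \<mu>\<^bsub>l+1\<^esub>(k)) D\<close>. Since \<open>m\<^sub>0 > 0\<close>, one of the \<open>m\<^sub>0\<close> factors \<open>T\<^sub>l\<close>
  can be written as \<open>A\<^bsub>l+1\<^esub> D\<close>, and its \<open>D\<close> can be pulled through all the factors with \<open>k > 0\<close>. What is
  left between \<open>A\<^bsub>l+1\<^esub>\<close> and \<open>D\<close> is an operator of the same kind with parameter \<open>l + 1\<close> and \<open>w - 1\<close> in
  place of \<open>w\<close>. By recursion the whole operator is a composition of
  \<open>D\<close>'s and \<open>A\<^sub>c\<close>'s with \<open>c > 0\<close>. The definition of \<open>ultraspherical_multiplier\<close> is this composition,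
  and \<open>ultraspherical_multiplier_raised_one\<close> verifies its eigenvalues.
\<close>

section \<open>Counting real and non-real zeros\<close>

lemma map_poly_of_real_mult:
  "map_poly complex_of_real (p * q) = map_poly complex_of_real p * map_poly complex_of_real q"
  by (intro poly_eqI) (simp add: coeff_map_poly coeff_mult)

lemma poly_map_poly_of_real:
  "poly (map_poly complex_of_real p) (of_real x) = of_real (poly p x)"
  by (induction p) (simp_all add: map_poly_pCons)

lemma order_map_poly_of_real:
  assumes "p \<noteq> 0"
  shows "order (of_real x) (map_poly complex_of_real p) = order x p"
proof -
  let ?c = "map_poly complex_of_real"
  obtain q where q: "p = [:- x, 1:] ^ order x p * q" "\<not> [:- x, 1:] dvd q"
    using order_decomp[OF assms] by blast
  have pow: "?c ([:- x, 1:] ^ n) = [:- of_real x, 1:] ^ n" for n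
    by (induction n) (simp_all add: map_poly_of_real_mult map_poly_pCons del: mult_pCons_left)
  have c: "?c p = [:- of_real x, 1:] ^ order x p * ?c q"
    by (subst q(1)) (simp only: map_poly_of_real_mult pow)
  have "poly (?c q) (of_real x) \<noteq> 0"
    using q(2) by (simp add: poly_map_poly_of_real poly_eq_0_iff_dvd)
  hence "\<not> [:- of_real x, 1:] dvd ?c q"
    by (simp add: poly_eq_0_iff_dvd)
  hence "\<not> [:- of_real x, 1:] ^ Suc (order x p) dvd ?c p"
    unfolding c by (simp only: power_Suc2 dvd_mult_cancel_left) simp
  thus ?thesis
    by (intro order_unique_lemma) (simp_all add: c)
qed

lemma size_proots_eq_sum_order:
  fixes p :: "'a :: idom poly"
  assumes "p \<noteq> 0"
  shows "size (proots p) = (\<Sum>x | poly p x = 0. order x p)"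
  using assms by (simp add: size_multiset_overloaded_eq)

text \<open>
  By the fundamental theorem of algebra, bounding the number of non-real zeros from above is the
  same as bounding the number of real zeros from below, once the degree is known. This is what makes
  Rolle's theorem applicable.
\<close>

lemma nonreal_zero_count_plus_size_proots:
  assumes "p \<noteq> 0"
  shows "nonreal_zero_count p + size (proots p) = degree p"
proof -
  let ?q = "map_poly complex_of_real p"
  have q0: "?q \<noteq> 0"
    using assms by (simp add: map_poly_eq_0_iff)
  have fin: "finite {z. poly ?q z = 0}"
    using q0 by (rule poly_roots_finite)
  have real_zeros: "{z. z \<in> \<real> \<and> poly ?q z = 0} = of_real ` {x. poly p x = 0}"
    by (auto simp: poly_map_poly_of_real elim!: Reals_cases)
  have "degree p = size (proots ?q)"
    by (simp add: size_proots_complex degree_map_poly)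
  also have "\<dots> = (\<Sum>z | poly ?q z = 0. order z ?q)"
    by (rule size_proots_eq_sum_order[OF q0])
  also have "{z. poly ?q z = 0} = {z. z \<notin> \<real> \<and> poly ?q z = 0} \<union> {z. z \<in> \<real> \<and> poly ?q z = 0}"
    by auto
  also have "(\<Sum>z\<in>\<dots>. order z ?q) = nonreal_zero_count p
               + (\<Sum>z | z \<in> \<real> \<and> poly ?q z = 0. order z ?q)"
    using assms by (subst sum.union_disjoint)
      (auto simp: nonreal_zero_count_def intro: finite_subset[OF _ fin])
  also have "(\<Sum>z | z \<in> \<real> \<and> poly ?q z = 0. order z ?q) = (\<Sum>x | poly p x = 0. order x p)"
    unfolding real_zeros using assms
    by (subst sum.reindex) (auto simp: order_map_poly_of_real inj_on_def)
  finally show ?thesis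
    using assms by (simp add: size_proots_eq_sum_order)
qed

text \<open>
  Mapping each element of \<open>S\<close> but the last to a point of \<open>Z\<close> before its successor is injective.
\<close>

lemma card_le_Suc_card_gaps:
  fixes S Z :: "'a :: linorder set"
  assumes "finite S" "finite Z"
    and gaps: "\<And>a b. a \<in> S \<Longrightarrow> b \<in> S \<Longrightarrow> a < b \<Longrightarrow> {a<..<b} \<inter> S = {} \<Longrightarrow> \<exists>c\<in>Z. a < c \<and> c < b"
  shows "card S \<le> Suc (card (Z - S))"
proof (cases "S = {}")
  case False
  define succ where "succ a = Min {s \<in> S. a < s}" for a
  have succ: "succ a \<in> S" "a < succ a" "\<And>s. s \<in> S \<Longrightarrow> a < s \<Longrightarrow> succ a \<le> s"
    if a: "a \<in> S - {Max S}" for a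
  proof -
    have "Max S \<in> {s \<in> S. a < s}"
      using a assms(1) False by (auto simp: less_le)
    hence ne: "{s \<in> S. a < s} \<noteq> {}"
      by blast
    have "succ a \<in> {s \<in> S. a < s}"
      unfolding succ_def using assms(1) by (intro Min_in ne) auto
    thus "succ a \<in> S" "a < succ a"
      by auto
    show "succ a \<le> s" if "s \<in> S" "a < s" for s
      unfolding succ_def using assms(1) that by (intro Min_le) auto
  qed
  have "\<exists>c\<in>Z. a < c \<and> c < succ a" if a: "a \<in> S - {Max S}" for a
    using a succ[OF a] by (intro gaps) (auto simp: not_less[symmetric])
  then obtain g where g: "\<And>a. a \<in> S - {Max S} \<Longrightarrow> g a \<in> Z \<and> a < g a \<and> g a < succ a"
    by metis
  have less: "g a < g b" if "a \<in> S - {Max S}" "b \<in> S - {Max S}" "a < b" for a b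
    using g[OF that(1)] g[OF that(2)] succ(3)[OF that(1), of b] that by auto
  have "inj_on g (S - {Max S})"
    by (rule linorder_inj_onI) (use less in \<open>fastforce+\<close>)
  moreover have "g ` (S - {Max S}) \<subseteq> Z - S"
    using g succ(3) by (auto simp: not_le[symmetric])
  ultimately have "card (S - {Max S}) \<le> card (Z - S)"
    using assms(2) by (intro card_inj_on_le) auto
  thus ?thesis
    using assms(1) False by simp
qed simp

text \<open>
  The form in which Rolle's theorem is used: the zeros in the gaps of \<open>S\<close> come on top of the
  multiplicities that \<open>p\<close> has on \<open>S\<close> itself.
\<close>

lemma size_proots_ge_gaps:
  fixes p :: "real poly"
  assumes "p \<noteq> 0" "finite S"
    and gaps: "\<And>a b. a \<in> S \<Longrightarrow> b \<in> S \<Longrightarrow> a < b \<Longrightarrow> {a<..<b} \<inter> S = {} \<Longrightarrow>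
                 \<exists>c. a < c \<and> c < b \<and> poly p c = 0"
  shows "(\<Sum>x\<in>S. order x p) + card S \<le> Suc (size (proots p))"
proof -
  define Z where "Z = {x. poly p x = 0}"
  have Z: "finite Z"
    unfolding Z_def using assms(1) by (rule poly_roots_finite)
  have "card S \<le> Suc (card (Z - S))"
    using assms(2) Z
  proof (rule card_le_Suc_card_gaps)
    fix a b assume "a \<in> S" "b \<in> S" "a < b" "{a<..<b} \<inter> S = {}"
    thus "\<exists>c\<in>Z. a < c \<and> c < b"
      using gaps[of a b] by (auto simp: Z_def)
  qed
  moreover have "card (Z - S) \<le> (\<Sum>x\<in>Z - S. order x p)"
    using assms(1) sum_mono[of "Z - S" "\<lambda>_. 1" "\<lambda>x. order x p"]
    by (auto simp: Z_def order_root Suc_le_eq)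
  moreover have "size (proots p) = (\<Sum>x\<in>Z \<union> S. order x p)"
    unfolding size_proots_eq_sum_order[OF assms(1)] Z_def
    using assms(1,2) poly_roots_finite[OF assms(1)]
    by (intro sum.mono_neutral_left) (auto simp: order_root)
  moreover have "(\<Sum>x\<in>Z \<union> S. order x p) = (\<Sum>x\<in>S. order x p) + (\<Sum>x\<in>Z - S. order x p)"
    using Z assms(2) by (subst sum.union_disjoint[symmetric]) (auto intro!: sum.cong)
  ultimately show ?thesis
    by linarith
qed

section \<open>Two operators that do not create non-real zeros\<close>

lemma nonreal_zero_count_pderiv_le:
  "nonreal_zero_count (pderiv p) \<le> nonreal_zero_count p"
proof (cases "pderiv p = 0")
  case False
  hence p: "p \<noteq> 0" "degree p \<noteq> 0"
    by (auto simp: pderiv_eq_0_iff)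
  define S where "S = {x. poly p x = 0}"
  have S: "finite S"
    unfolding S_def using p(1) by (rule poly_roots_finite)
  have "(\<Sum>x\<in>S. order x (pderiv p)) + card S \<le> Suc (size (proots (pderiv p)))"
  proof (rule size_proots_ge_gaps[OF False S])
    fix a b :: real
    assume "a \<in> S" "b \<in> S" "a < b"
    hence "\<exists>z>a. z < b \<and> DERIV (poly p) z :> 0"
      by (intro Rolle) (auto simp: S_def intro!: continuous_intros poly_differentiable)
    thus "\<exists>c. a < c \<and> c < b \<and> poly (pderiv p) c = 0"
      using poly_DERIV DERIV_unique by blast
  qed
  moreover have "size (proots p) = (\<Sum>x\<in>S. order x (pderiv p)) + card S"
  proof -
    have "size (proots p) = (\<Sum>x\<in>S. Suc (order x (pderiv p)))"
      unfolding size_proots_eq_sum_order[OF p(1)] S_def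
      using p(1) order_pderiv by (intro sum.cong) auto
    thus ?thesis
      by (simp add: sum.distrib Suc_eq_plus1 del: One_nat_def add_Suc_right)
  qed
  ultimately show ?thesis
    using nonreal_zero_count_plus_size_proots[OF p(1)]
      nonreal_zero_count_plus_size_proots[OF False] p(2)
    by (simp add: degree_pderiv)
qed (simp add: nonreal_zero_count_def)

text \<open>
  The first-order operator that raises the degree by one and lowers the parameter of the
  ultraspherical family. The derivative of \<open>(x\<^sup>2 - 1)\<^sup>c q\<close> is \<open>(x\<^sup>2 - 1)\<close> to the power \<open>c - 1\<close> times
  \<open>jacobi_raise c q\<close>.
\<close>

definition jacobi_raise :: "real \<Rightarrow> real poly \<Rightarrow> real poly" where
  "jacobi_raise c q = [:-1, 0, 1:] * pderiv q + smult (2 * c) ([:0, 1:] * q)"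

lemma jacobi_raise_0 [simp]: "jacobi_raise c 0 = 0"
  by (simp add: jacobi_raise_def)

lemma jacobi_raise_add: "jacobi_raise c (p + q) = jacobi_raise c p + jacobi_raise c q"
  by (simp add: jacobi_raise_def pderiv_add smult_add_right algebra_simps)

lemma jacobi_raise_smult: "jacobi_raise c (smult a p) = smult a (jacobi_raise c p)"
  by (simp add: jacobi_raise_def pderiv_smult smult_add_right algebra_simps)

lemma poly_jacobi_raise:
  "poly (jacobi_raise c q) x = (x\<^sup>2 - 1) * poly (pderiv q) x + 2 * c * x * poly q x"
  by (simp add: jacobi_raise_def power2_eq_square algebra_simps)

lemma coeff_jacobi_raise_0: "coeff (jacobi_raise c q) 0 = - coeff q 1"
  by (simp add: jacobi_raise_def coeff_pderiv)

lemma coeff_jacobi_raise_Suc: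
  "coeff (jacobi_raise c q) (Suc n) =
     (real n + 2 * c) * coeff q n - (real n + 2) * coeff q (Suc (Suc n))"
  by (cases n) (simp_all add: jacobi_raise_def coeff_pderiv algebra_simps)

lemma degree_jacobi_raise:
  assumes "c > 0" "q \<noteq> 0"
  shows "degree (jacobi_raise c q) = Suc (degree q)"
proof (rule antisym)
  show "degree (jacobi_raise c q) \<le> Suc (degree q)"
  proof (rule degree_le, intro allI impI)
    fix i assume "Suc (degree q) < i"
    thus "coeff (jacobi_raise c q) i = 0"
      by (cases i) (simp_all add: coeff_jacobi_raise_Suc coeff_eq_0)
  qed
  have "coeff (jacobi_raise c q) (Suc (degree q)) \<noteq> 0"
    using assms by (simp add: coeff_jacobi_raise_Suc coeff_eq_0 add_nonneg_eq_0_iff)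
  thus "Suc (degree q) \<le> degree (jacobi_raise c q)"
    by (rule le_degree)
qed

lemma jacobi_raise_neq_0:
  assumes "c > 0" "q \<noteq> 0"
  shows "jacobi_raise c q \<noteq> 0"
  using degree_jacobi_raise[OF assms] by auto

lemma order_jacobi_raise_ge:
  assumes "c > 0" "q \<noteq> 0"
  shows "order x q \<le> order x (jacobi_raise c q) + (if x \<in> {-1, 1} then 0 else 1)"
proof -
  have q: "[:- x, 1:] ^ order x q dvd q"
    by (rule order_1)
  have dq: "[:- x, 1:] ^ (order x q - 1) dvd pderiv q"
  proof (cases "poly q x = 0")
    case True
    thus ?thesis
      using order_1[of x "pderiv q"] order_pderiv[OF assms(2) True] by simp
  qed (simp add: order_0I)
  show ?thesis
  proof (cases "x \<in> {-1, 1}")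
    case True
    \<comment> \<open>The factor \<open>x\<^sup>2 - 1\<close> makes up for the zero lost in differentiating.\<close>
    have "[:- x, 1:] dvd [:-1, 0, 1:]"
      using True by (subst poly_eq_0_iff_dvd[symmetric]) auto
    hence "[:- x, 1:] * [:- x, 1:] ^ (order x q - 1) dvd [:-1, 0, 1:] * pderiv q"
      using dq by (rule mult_dvd_mono)
    moreover have "[:- x, 1:] ^ order x q dvd [:- x, 1:] * [:- x, 1:] ^ (order x q - 1)"
      by (cases "order x q") simp_all
    ultimately have "[:- x, 1:] ^ order x q dvd [:-1, 0, 1:] * pderiv q"
      by (rule dvd_trans[rotated])
    hence "[:- x, 1:] ^ order x q dvd jacobi_raise c q"
      unfolding jacobi_raise_def using q by (intro dvd_add dvd_smult) (simp_all only: dvd_mult)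
    thus ?thesis
      using True jacobi_raise_neq_0[OF assms] by (simp add: order_divides)
  next
    case False
    have "[:- x, 1:] ^ (order x q - 1) dvd q"
      using q by (rule power_le_dvd) simp
    hence "[:- x, 1:] ^ (order x q - 1) dvd jacobi_raise c q"
      unfolding jacobi_raise_def using dq by (intro dvd_add dvd_smult dvd_mult)
    thus ?thesis
      using False jacobi_raise_neq_0[OF assms] by (auto simp: order_divides)
  qed
qed

text \<open>
  Rolle's theorem for \<open>\<bar>x\<^sup>2 - 1\<bar>\<^sup>c q\<close>, which vanishes at \<open>\<plusminus>1\<close> as well because \<open>c > 0\<close>. Between two zeros
  with \<open>\<plusminus>1\<close> not in the interior, \<open>x\<^sup>2 - 1\<close> keeps its sign, so the function is differentiable there.
\<close>

lemma jacobi_raise_root_between: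
  assumes "c > 0" "a < b"
    and a: "a \<in> {-1, 1} \<or> poly q a = 0" and b: "b \<in> {-1, 1} \<or> poly q b = 0"
    and gap: "{a<..<b} \<inter> {-1, 1} = {}"
  shows "\<exists>x. a < x \<and> x < b \<and> poly (jacobi_raise c q) x = 0"
proof -
  define h where "h x = \<bar>x\<^sup>2 - 1\<bar> powr c * poly q x" for x
  have h_deriv: "(h has_real_derivative
      sgn (x\<^sup>2 - 1) * \<bar>x\<^sup>2 - 1\<bar> powr (c - 1) * poly (jacobi_raise c q) x) (at x)"
    if x: "a < x" "x < b" for x
  proof -
    define s where "s = sgn (x\<^sup>2 - 1)"
    have ne: "x\<^sup>2 - 1 \<noteq> 0"
      using x gap by (auto simp: power2_eq_1_iff)
    have abs_eq: "\<bar>x\<^sup>2 - 1\<bar> = s * (x\<^sup>2 - 1)"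
      using ne by (auto simp: s_def sgn_if)
    have d_abs: "((\<lambda>x. \<bar>x\<^sup>2 - 1\<bar>) has_real_derivative s * (2 * x)) (at x)"
    proof (rule has_field_derivative_transform_within_open)
      show "((\<lambda>t. s * (t\<^sup>2 - 1)) has_real_derivative s * (2 * x)) (at x)"
        by (auto intro!: derivative_eq_intros)
      show "open {t. 0 < s * (t\<^sup>2 - 1)}"
        by (intro open_Collect_less continuous_intros)
      show "x \<in> {t. 0 < s * (t\<^sup>2 - 1)}"
        using ne abs_eq by simp
      have "\<bar>s\<bar> = 1"
        using ne by (simp add: s_def abs_sgn_eq)
      thus "s * (t\<^sup>2 - 1) = \<bar>t\<^sup>2 - 1\<bar>" if "t \<in> {t. 0 < s * (t\<^sup>2 - 1)}" for t
        using that abs_mult[of s "t\<^sup>2 - 1"] by simp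
    qed
    have "((\<lambda>x. \<bar>x\<^sup>2 - 1\<bar> powr c) has_real_derivative
            c * \<bar>x\<^sup>2 - 1\<bar> powr (c - 1) * (s * (2 * x))) (at x)"
      using DERIV_fun_powr[OF d_abs, of c] ne by simp
    from DERIV_mult[OF this poly_DERIV[of q x]]
    have "(h has_real_derivative c * \<bar>x\<^sup>2 - 1\<bar> powr (c - 1) * (s * (2 * x)) * poly q x
            + poly (pderiv q) x * \<bar>x\<^sup>2 - 1\<bar> powr c) (at x)"
      unfolding h_def .
    moreover have "\<bar>x\<^sup>2 - 1\<bar> powr c = \<bar>x\<^sup>2 - 1\<bar> powr (c - 1) * (s * (x\<^sup>2 - 1))"
      using ne abs_eq by (simp add: powr_diff)
    ultimately show ?thesis
      by (simp add: s_def poly_jacobi_raise algebra_simps)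
  qed
  have "\<exists>z>a. z < b \<and> DERIV h z :> 0"
  proof (rule Rolle[OF \<open>a < b\<close>])
    show "h a = h b"
      using a b by (auto simp: h_def)
    show "continuous_on {a..b} h"
      unfolding h_def using \<open>c > 0\<close>
      by (intro continuous_intros continuous_on_powr') auto
    show "h differentiable at x" if "a < x" "x < b" for x
      using h_deriv[OF that] unfolding real_differentiable_def by blast
  qed
  then obtain z where z: "a < z" "z < b" "DERIV h z :> 0"
    by blast
  have "sgn (z\<^sup>2 - 1) * \<bar>z\<^sup>2 - 1\<bar> powr (c - 1) * poly (jacobi_raise c q) z = 0"
    using DERIV_unique[OF h_deriv[OF z(1,2)] z(3)] .
  moreover have "z\<^sup>2 - 1 \<noteq> 0"
    using z gap by (auto simp: power2_eq_1_iff)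
  ultimately show ?thesis
    using z by (auto simp: sgn_zero_iff)
qed

text \<open>
  Let \<open>S\<close> consist of the zeros of \<open>q\<close> and \<open>\<plusminus>1\<close>. Passing to \<open>jacobi_raise c q\<close> costs at most one multiplicity
  at each of the \<open>card S - 2\<close> points other than \<open>\<plusminus>1\<close> and creates a zero in each of the \<open>card S - 1\<close>
  gaps: a net gain of at least one real zero, which matches the increase of the degree.
\<close>

lemma nonreal_zero_count_jacobi_raise_le:
  assumes "c > 0"
  shows "nonreal_zero_count (jacobi_raise c q) \<le> nonreal_zero_count q"
proof (cases "q = 0")
  case False
  let ?r = "jacobi_raise c q"
  have r0: "?r \<noteq> 0"
    using assms False by (rule jacobi_raise_neq_0)
  define S where "S = {x. poly q x = 0} \<union> {-1, 1}"
  have S: "finite S" "{-1, 1} \<subseteq> S"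
    unfolding S_def using poly_roots_finite[OF False] by auto
  have "(\<Sum>x\<in>S. order x ?r) + card S \<le> Suc (size (proots ?r))"
    by (rule size_proots_ge_gaps[OF r0 S(1)], rule jacobi_raise_root_between[OF assms])
      (auto simp: S_def)
  moreover have "size (proots q) + 2 \<le> (\<Sum>x\<in>S. order x ?r) + card S"
  proof -
    have "size (proots q) = (\<Sum>x\<in>S. order x q)"
      unfolding size_proots_eq_sum_order[OF False]
      using S(1) False by (intro sum.mono_neutral_left) (auto simp: S_def order_root)
    also have "\<dots> \<le> (\<Sum>x\<in>S. order x ?r + (if x \<in> {-1, 1} then 0 else 1))"
      by (intro sum_mono order_jacobi_raise_ge assms False)
    also have "\<dots> = (\<Sum>x\<in>S. order x ?r) + (\<Sum>x\<in>S. if x \<in> {-1, 1} then 0 else 1)"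
      by (rule sum.distrib)
    also have "(\<Sum>x\<in>S. if x \<in> {-1, 1} then 0 else 1 :: nat) = card (S - {-1, 1})"
      using S(1) by (subst sum.If_cases) (auto simp: set_diff_eq Int_def Compl_eq)
    finally have "size (proots q) \<le> (\<Sum>x\<in>S. order x ?r) + card (S - {-1, 1})" .
    moreover have "card (S - {-1, 1}) + 2 = card S"
      using S card_Diff_subset[of "{-1, 1}" S] card_mono[OF S] by simp
    ultimately show ?thesis
      by linarith
  qed
  ultimately show ?thesis
    using nonreal_zero_count_plus_size_proots[OF False]
      nonreal_zero_count_plus_size_proots[OF r0] degree_jacobi_raise[OF assms False]
    by linarith
qed simp

section \<open>Ultraspherical polynomials\<close>

text \<open>
  The composition of \<open>jacobi_raise c\<close> for \<open>c = l + 1, \<dots>, l + n\<close>, innermost \<open>c = l + n\<close>, applied to the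
  constant 1. This is the ultraspherical polynomial without its normalising factor.
\<close>

primrec raised_one :: "real \<Rightarrow> nat \<Rightarrow> real poly" where
  "raised_one l 0 = 1"
| "raised_one l (Suc n) = jacobi_raise (l + 1) (raised_one (l + 1) n)"

lemma degree_raised_one:
  assumes "l > -1"
  shows "raised_one l n \<noteq> 0 \<and> degree (raised_one l n) = n"
  using assms
proof (induction n arbitrary: l)
  case (Suc n)
  have "raised_one (l + 1) n \<noteq> 0 \<and> degree (raised_one (l + 1) n) = n"
    using Suc.prems by (intro Suc.IH) simp
  thus ?case
    using Suc.prems degree_jacobi_raise[of "l + 1" "raised_one (l + 1) n"]
      jacobi_raise_neq_0[of "l + 1" "raised_one (l + 1) n"] by simp
qed simp

text \<open>
  Each derivative in Rodrigues' formula lowers the exponent of the weight \<open>(1 - x\<^sup>2)\<^sup>c\<close> by one and acts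
  on the polynomial factor as \<open>- jacobi_raise c\<close>; the sign comes from \<open>1 - x\<^sup>2\<close> in place of \<open>x\<^sup>2 - 1\<close>.
\<close>

lemma iterated_deriv_ultraspherical_weight:
  assumes "x \<in> {-1<..<1}"
  shows "(deriv ^^ k) (\<lambda>t. (1 - t) powr a * (1 + t) powr a) x =
           (-1) ^ k * (1 - x) powr (a - real k) * (1 + x) powr (a - real k)
             * poly (raised_one (a - real k) k) x"
  using assms
proof (induction k arbitrary: x)
  case (Suc k)
  let ?w = "\<lambda>t. (1 - t) powr a * (1 + t) powr a :: real"
  define c where "c = a - real k"
  define q where "q = raised_one c k"
  have pos: "1 - x > 0" "1 + x > 0"
    using Suc.prems by auto
  have "eventually (\<lambda>y. y \<in> {-1<..<1}) (nhds x)"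
    using Suc.prems by (intro eventually_nhds_in_open) auto
  hence ev: "eventually (\<lambda>y. (deriv ^^ k) ?w y =
               (-1) ^ k * ((1 - y) powr c * (1 + y) powr c * poly q y)) (nhds x)"
    by eventually_elim (simp add: Suc.IH c_def q_def)
  have split: "(1 - x) powr c = (1 - x) powr (c - 1) * (1 - x)"
    "(1 + x) powr c = (1 + x) powr (c - 1) * (1 + x)"
    using pos by (simp_all add: powr_diff)
  have "((\<lambda>y. (1 - y) powr c * (1 + y) powr c * poly q y) has_real_derivative
      ((- (c * (1 - x) powr (c - 1))) * (1 + x) powr c
        + c * (1 + x) powr (c - 1) * (1 - x) powr c) * poly q x
      + poly (pderiv q) x * ((1 - x) powr c * (1 + x) powr c)) (at x)"
    using pos by (auto intro!: derivative_eq_intros simp: powr_diff)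
  also have "((- (c * (1 - x) powr (c - 1))) * (1 + x) powr c
        + c * (1 + x) powr (c - 1) * (1 - x) powr c) * poly q x
      + poly (pderiv q) x * ((1 - x) powr c * (1 + x) powr c) =
      - ((1 - x) powr (c - 1) * (1 + x) powr (c - 1) * poly (jacobi_raise c q) x)"
    unfolding split by (simp add: poly_jacobi_raise power2_eq_square algebra_simps)
  finally have "((\<lambda>y. (-1) ^ k * ((1 - y) powr c * (1 + y) powr c * poly q y)) has_real_derivative
      (-1) ^ k * - ((1 - x) powr (c - 1) * (1 + x) powr (c - 1) * poly (jacobi_raise c q) x)) (at x)"
    by (rule DERIV_cmult)
  from DERIV_imp_deriv[OF this] have "(deriv ^^ Suc k) ?w x =
      (-1) ^ k * - ((1 - x) powr (c - 1) * (1 + x) powr (c - 1) * poly (jacobi_raise c q) x)"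
    using deriv_cong_ev[OF ev refl] by simp
  moreover have "a - real (Suc k) = c - 1" "raised_one (c - 1) (Suc k) = jacobi_raise c q"
    by (simp_all add: c_def q_def)
  ultimately show ?case
    by (simp only: power_Suc)
qed simp

lemma ultraspherical_poly_eq_raised_one:
  "ultraspherical_poly l n = smult (1 / (2 ^ n * fact n)) (raised_one l n)"
  unfolding ultraspherical_poly_def jacobi_poly_def
proof (rule the1_equality[OF ex1_jacobi_poly], intro ballI)
  fix x :: real
  assume x: "x \<in> {-1<..<1}"
  have sign: "(-1) ^ n * (-1) ^ n = (1 :: real)"
    by (simp flip: power_mult_distrib)
  show "poly (smult (1 / (2 ^ n * fact n)) (raised_one l n)) x = jacobi_rodrigues n l l x"
    unfolding jacobi_rodrigues_def iterated_deriv_ultraspherical_weight[OF x]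
    using x sign by (simp add: powr_minus field_simps)
qed

definition ultraspherical_eigenvalue :: "real \<Rightarrow> nat \<Rightarrow> real" where
  "ultraspherical_eigenvalue l n = real n * (real n + 1 + 2 * l)"

lemma ultraspherical_eigenvalue_0 [simp]: "ultraspherical_eigenvalue l 0 = 0"
  by (simp add: ultraspherical_eigenvalue_def)

lemma ultraspherical_eigenvalue_Suc:
  "ultraspherical_eigenvalue l (Suc n) = ultraspherical_eigenvalue (l + 1) n + 2 * (l + 1)"
  by (simp add: ultraspherical_eigenvalue_def algebra_simps)

text \<open>
  The intertwining relation in operator form: for \<open>c = l + 1\<close> it says that \<open>D A\<^bsub>l+1\<^esub>\<close> equals
  \<open>T\<^bsub>l+1\<^esub> + 2 (l + 1)\<close>, where \<open>2 (l + 1)\<close> is the eigenvalue for \<open>n = 1\<close>.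
\<close>

lemma pderiv_jacobi_raise:
  "pderiv (jacobi_raise c q) = jacobi_raise (c + 1) (pderiv q) + smult (2 * c) q"
proof (rule poly_eqI)
  fix n
  show "coeff (pderiv (jacobi_raise c q)) n =
          coeff (jacobi_raise (c + 1) (pderiv q) + smult (2 * c) q) n"
    by (cases n)
      (simp_all add: coeff_pderiv coeff_jacobi_raise_0 coeff_jacobi_raise_Suc algebra_simps)
qed

text \<open>
  Differentiation undoes the outermost \<open>jacobi_raise\<close> up to a factor. This one identity contains
  the ultraspherical differential equation and drives the eigenvalue computation for the multiplier.
\<close>

lemma pderiv_raised_one_Suc:
  "pderiv (raised_one l (Suc n)) =
     smult (ultraspherical_eigenvalue l (Suc n)) (raised_one (l + 1) n)"
proof (induction n arbitrary: l)
  case 0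
  show ?case
    by (simp add: pderiv_jacobi_raise ultraspherical_eigenvalue_Suc smult_one)
next
  case (Suc n)
  have "pderiv (raised_one l (Suc (Suc n))) =
      jacobi_raise (l + 1 + 1) (pderiv (raised_one (l + 1) (Suc n)))
        + smult (2 * (l + 1)) (raised_one (l + 1) (Suc n))"
    by (simp only: raised_one.simps(2)[of l] pderiv_jacobi_raise)
  also have "jacobi_raise (l + 1 + 1) (pderiv (raised_one (l + 1) (Suc n))) =
      smult (ultraspherical_eigenvalue (l + 1) (Suc n)) (raised_one (l + 1) (Suc n))"
    unfolding Suc.IH jacobi_raise_smult by (simp only: raised_one.simps)
  finally show ?case
    by (simp only: ultraspherical_eigenvalue_Suc[of l] smult_add_left)
qed

text \<open>
  The ultraspherical differential operator \<open>(x\<^sup>2 - 1) D\<^sup>2 + 2 (l + 1) x D\<close> in factored form.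
\<close>

definition gegenbauer_op :: "real \<Rightarrow> real poly \<Rightarrow> real poly" where
  "gegenbauer_op l p = jacobi_raise (l + 1) (pderiv p)"

lemma gegenbauer_op_raised_one:
  "gegenbauer_op l (raised_one l n) = smult (ultraspherical_eigenvalue l n) (raised_one l n)"
proof (cases n)
  case (Suc k)
  show ?thesis
    unfolding gegenbauer_op_def Suc pderiv_raised_one_Suc
    by (simp only: jacobi_raise_smult raised_one.simps)
qed (simp add: gegenbauer_op_def)

section \<open>Polynomial sequences with exact degrees are bases\<close>

lemma is_poly_basis_if_degree_eq:
  fixes b :: "nat \<Rightarrow> real poly"
  assumes deg: "\<And>n. degree (b n) = n" and nz: "\<And>n. b n \<noteq> 0"
  shows "is_poly_basis b"
proof -
  \<comment> \<open>Finitely many members span exactly the polynomials of smaller degree, so each new one is independent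
    of the earlier ones.\<close>
  have low: "real_poly.independent (b ` {..<n}) \<and> real_poly.span (b ` {..<n}) = {p. p = 0 \<or> degree p < n}"
    for n
  proof (induction n)
    case 0
    show ?case
      using real_poly.independent_empty by simp
  next
    case (Suc n)
    have notin: "b n \<notin> real_poly.span (b ` {..<n})"
      using Suc deg nz by simp
    have "p \<in> real_poly.span (insert (b n) (b ` {..<n}))" if p: "p = 0 \<or> degree p < Suc n" for p
    proof -
      define k where "k = coeff p n / coeff (b n) n"
      have lead: "coeff (b n) n \<noteq> 0"
        using deg[of n] nz[of n] by (metis leading_coeff_0_iff)
      have "p - smult k (b n) = 0 \<or> degree (p - smult k (b n)) < n"
      proof -
        have "degree (p - smult k (b n)) \<le> n"
          using p deg[of n] by (intro degree_diff_le) (auto intro: order.trans[OF degree_smult_le])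
        moreover have "coeff (p - smult k (b n)) n = 0"
          using lead by (simp add: k_def)
        ultimately show ?thesis
          by (metis leading_coeff_0_iff le_neq_implies_less)
      qed
      thus ?thesis
        using Suc by (auto simp: real_poly.span_breakdown_eq)
    qed
    moreover have "p = 0 \<or> degree p < Suc n" if p: "p \<in> real_poly.span (insert (b n) (b ` {..<n}))" for p
    proof -
      obtain k where "p - smult k (b n) \<in> real_poly.span (b ` {..<n})"
        using p real_poly.span_breakdown_eq by blast
      hence k: "p - smult k (b n) = 0 \<or> degree (p - smult k (b n)) < n"
        using Suc by blast
      have "degree ((p - smult k (b n)) + smult k (b n)) \<le> n"
        using k deg[of n] by (intro degree_add_le) (auto intro: order.trans[OF degree_smult_le])
      thus ?thesis
        by simp
    qed
    moreover have "real_poly.independent (insert (b n) (b ` {..<n}))"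
      using Suc notin by (intro real_poly.independent_insertI) simp_all
    ultimately show ?case
      unfolding lessThan_Suc image_insert by blast
  qed
  have range: "range b = (\<Union>n. b ` {..<n})"
    by auto
  have "real_poly.independent (\<Union>(range (\<lambda>n. b ` {..<n})))"
  proof (rule real_poly.independent_Union_directed)
    fix c d assume "c \<in> range (\<lambda>n. b ` {..<n})" "d \<in> range (\<lambda>n. b ` {..<n})"
    then obtain i j where "c = b ` {..<i}" "d = b ` {..<j}"
      by blast
    moreover have "b ` {..<i} \<subseteq> b ` {..<j} \<or> b ` {..<j} \<subseteq> b ` {..<i}"
      by (metis image_mono lessThan_subset_iff nat_le_linear)
    ultimately show "c \<subseteq> d \<or> d \<subseteq> c"
      by simp
  next
    fix c assume "c \<in> range (\<lambda>n. b ` {..<n})"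
    then obtain n where "c = b ` {..<n}"
      by blast
    thus "real_poly.independent c"
      using low[of n] by simp
  qed
  hence "real_poly.independent (range b)"
    unfolding range .
  moreover have "real_poly.span (range b) = UNIV"
  proof (intro UNIV_eq_I[symmetric])
    fix p
    have "p \<in> real_poly.span (b ` {..<Suc (degree p)})"
      using low[of "Suc (degree p)"] by simp
    also have "\<dots> \<subseteq> real_poly.span (range b)"
      by (intro real_poly.span_mono image_mono subset_UNIV)
    finally show "p \<in> real_poly.span (range b)" .
  qed
  moreover have "inj b"
    using deg by (metis injI)
  ultimately show ?thesis
    by (simp add: is_poly_basis_def)
qed

section \<open>The multiplier operator\<close>

text \<open>
  The product of the \<open>(gegenbauer_op l - ultraspherical_eigenvalue l k)\<close> to the power \<open>m k\<close> over \<open>k < w\<close>,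
  rearranged by the intertwining relation so that no single factor increases the number of non-real
  zeros. The rearrangement is correct for positive exponents: \<open>m 0 - 1\<close> is a truncated subtraction,
  and one more factor of \<open>gegenbauer_op l\<close> is always present.
\<close>

primrec ultraspherical_multiplier :: "nat \<Rightarrow> real \<Rightarrow> (nat \<Rightarrow> nat) \<Rightarrow> real poly \<Rightarrow> real poly" where
  "ultraspherical_multiplier 0 l m p = p"
| "ultraspherical_multiplier (Suc w) l m p =
     (gegenbauer_op l ^^ (m 0 - 1))
       (jacobi_raise (l + 1) (ultraspherical_multiplier w (l + 1) (m \<circ> Suc) (pderiv p)))"

lemma gegenbauer_op_smult: "gegenbauer_op l (smult a p) = smult a (gegenbauer_op l p)"
  by (simp add: gegenbauer_op_def pderiv_smult jacobi_raise_smult)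

lemma gegenbauer_op_funpow_add:
  "(gegenbauer_op l ^^ k) (p + q) = (gegenbauer_op l ^^ k) p + (gegenbauer_op l ^^ k) q"
  by (induction k) (simp_all add: gegenbauer_op_def pderiv_add jacobi_raise_add)

lemma gegenbauer_op_funpow_smult:
  "(gegenbauer_op l ^^ k) (smult a p) = smult a ((gegenbauer_op l ^^ k) p)"
  by (induction k) (simp_all add: gegenbauer_op_smult)

lemma gegenbauer_op_funpow_raised_one:
  "(gegenbauer_op l ^^ k) (raised_one l n) =
     smult (ultraspherical_eigenvalue l n ^ k) (raised_one l n)"
  by (induction k)
    (simp_all add: gegenbauer_op_raised_one gegenbauer_op_smult mult.commute)

lemma ultraspherical_multiplier_add:
  "ultraspherical_multiplier w l m (p + q) =
     ultraspherical_multiplier w l m p + ultraspherical_multiplier w l m q"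
  by (induction w arbitrary: l m p q)
    (simp_all add: pderiv_add jacobi_raise_add gegenbauer_op_funpow_add)

lemma ultraspherical_multiplier_smult:
  "ultraspherical_multiplier w l m (smult a p) = smult a (ultraspherical_multiplier w l m p)"
  by (induction w arbitrary: l m p)
    (simp_all add: pderiv_smult jacobi_raise_smult gegenbauer_op_funpow_smult)

lemma nonreal_zero_count_gegenbauer_op_funpow_le:
  assumes "l > -1"
  shows "nonreal_zero_count ((gegenbauer_op l ^^ k) p) \<le> nonreal_zero_count p"
proof (induction k)
  case (Suc k)
  have "nonreal_zero_count (gegenbauer_op l q) \<le> nonreal_zero_count q" for q
    unfolding gegenbauer_op_def using assms
    by (intro order.trans[OF nonreal_zero_count_jacobi_raise_le nonreal_zero_count_pderiv_le]) simp
  from order.trans[OF this Suc.IH] show ?case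
    by simp
qed simp

lemma nonreal_zero_count_ultraspherical_multiplier_le:
  assumes "l > -1"
  shows "nonreal_zero_count (ultraspherical_multiplier w l m p) \<le> nonreal_zero_count p"
  using assms
proof (induction w arbitrary: l m p)
  case (Suc w)
  let ?q = "ultraspherical_multiplier w (l + 1) (m \<circ> Suc) (pderiv p)"
  have "nonreal_zero_count (ultraspherical_multiplier (Suc w) l m p)
          \<le> nonreal_zero_count (jacobi_raise (l + 1) ?q)"
    using Suc.prems by (simp add: nonreal_zero_count_gegenbauer_op_funpow_le)
  also have "\<dots> \<le> nonreal_zero_count ?q"
    using Suc.prems by (intro nonreal_zero_count_jacobi_raise_le) simp
  also have "\<dots> \<le> nonreal_zero_count (pderiv p)"
    using Suc.prems by (intro Suc.IH) simp
  also have "\<dots> \<le> nonreal_zero_count p"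
    by (rule nonreal_zero_count_pderiv_le)
  finally show ?case .
qed simp

text \<open>
  Shifting \<open>(l, n, k)\<close> to \<open>(l + 1, n - 1, k - 1)\<close> changes all eigenvalues by the same constant, so the
  differences in the product are unchanged. The factor for \<open>k = 0\<close> is supplied by the derivative and
  the \<open>m 0 - 1\<close> copies of \<open>gegenbauer_op l\<close>; for \<open>n = 0\<close> both sides vanish.
\<close>

lemma ultraspherical_multiplier_raised_one:
  assumes "\<And>k. k < w \<Longrightarrow> m k > 0"
  shows "ultraspherical_multiplier w l m (raised_one l n) =
           smult (\<Prod>k<w. (ultraspherical_eigenvalue l n - ultraspherical_eigenvalue l k) ^ m k)
             (raised_one l n)"
  using assms
proof (induction w arbitrary: l m n)
  case (Suc w)
  let ?e = ultraspherical_eigenvalue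
  have zero: "ultraspherical_multiplier w l m 0 = 0" for l m
    using ultraspherical_multiplier_smult[where a = 0 and p = 0] by simp
  have fzero: "(gegenbauer_op l ^^ k) 0 = 0" for k
    using gegenbauer_op_funpow_smult[where a = 0 and p = 0] by simp
  have prod: "(\<Prod>k<Suc w. (?e l n - ?e l k) ^ m k) =
      ?e l n ^ m 0 * (\<Prod>k<w. (?e l n - ?e l (Suc k)) ^ m (Suc k))"
    by (simp only: prod.lessThan_Suc_shift) simp
  have m0: "?e l n ^ m 0 = ?e l n ^ (m 0 - 1) * ?e l n"
    using Suc.prems[of 0] by (cases "m 0") simp_all
  show ?case
  proof (cases n)
    case 0
    show ?thesis
      unfolding prod m0 unfolding 0 by (simp add: zero fzero)
  next
    case (Suc i)
    have "ultraspherical_multiplier w (l + 1) (m \<circ> Suc) (raised_one (l + 1) i) =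
        smult (\<Prod>k<w. (?e (l + 1) i - ?e (l + 1) k) ^ (m \<circ> Suc) k) (raised_one (l + 1) i)"
      using Suc.prems by (intro Suc.IH) simp
    also have "(\<Prod>k<w. (?e (l + 1) i - ?e (l + 1) k) ^ (m \<circ> Suc) k) =
        (\<Prod>k<w. (?e l n - ?e l (Suc k)) ^ m (Suc k))"
      unfolding Suc ultraspherical_eigenvalue_Suc by simp
    finally have "jacobi_raise (l + 1)
          (ultraspherical_multiplier w (l + 1) (m \<circ> Suc) (pderiv (raised_one l n))) =
        smult (?e l n * (\<Prod>k<w. (?e l n - ?e l (Suc k)) ^ m (Suc k))) (raised_one l n)"
      unfolding Suc pderiv_raised_one_Suc
      by (simp add: ultraspherical_multiplier_smult jacobi_raise_smult comp_def)
    thus ?thesis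
      unfolding prod m0
      by (simp add: gegenbauer_op_funpow_smult gegenbauer_op_funpow_raised_one mult_ac)
  qed
qed simp

theorem theorem14:
  fixes l :: real and w :: nat and m :: "nat \<Rightarrow> nat"
  assumes "l > -1" and "w > 0" and "\<And>k. k < w \<Longrightarrow> m k > 0"
  shows "CZDS (ultraspherical_poly l)
           (\<lambda>n. \<Prod>k<w. (real n * (real n + 1 + 2 * l) - real k * (real k + 1 + 2 * l)) ^ m k)"
  unfolding CZDS_def
proof (intro conjI exI allI)
  show "is_poly_basis (ultraspherical_poly l)"
    using degree_raised_one[OF assms(1)]
    by (intro is_poly_basis_if_degree_eq) (simp_all add: ultraspherical_poly_eq_raised_one)
  show "Vector_Spaces.linear smult smult (ultraspherical_multiplier w l m)"
    unfolding Vector_Spaces.linear_iff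
    by (intro conjI allI real_poly.vector_space_axioms ultraspherical_multiplier_add
          ultraspherical_multiplier_smult)
  show "ultraspherical_multiplier w l m (ultraspherical_poly l n) =
      smult (\<Prod>k<w. (real n * (real n + 1 + 2 * l) - real k * (real k + 1 + 2 * l)) ^ m k)
        (ultraspherical_poly l n)" for n
    using ultraspherical_multiplier_raised_one[of w m l n, OF assms(3)]
    by (simp add: ultraspherical_poly_eq_raised_one ultraspherical_multiplier_smult
          ultraspherical_eigenvalue_def mult.commute)
  show "nonreal_zero_count (ultraspherical_multiplier w l m p) \<le> nonreal_zero_count p" for p
    using assms(1) by (rule nonreal_zero_count_ultraspherical_multiplier_le)
qed

end
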